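(* Let $X=Q_x\widetilde X\in\mathbb{R}^{m\times n}$ be the data matrix of snapshots received so far, where $Q_x\in\mathbb{R}^{m\times r_x}$ has orthonormal columns and $\widetilde X\in\mathbb{R}^{r_x\times n}$ has full row rank, and let $G_x=\widetilde X\widetilde X^T$. Let $x_{new}\in\mathbb{R}^m$ be a new snapshot with $x_{new}\notin\mathcal{R}(X)$, and set $g_x=Q_x^Tx_{new}$, $\gamma_x=\|x_{new}-Q_xg_x\|_2$ and $$G_{x,new}=\begin{pmatrix}G_x&\mathbf{0}\\ \mathbf{0}&0\end{pmatrix}+\begin{pmatrix}g_x\\ \gamma_x\end{pmatrix}\begin{pmatrix}g_x^T&\gamma_x\end{pmatrix}.$$ Then $G_{x,new}$ is invertible and $$G_{x,new}^{-1}=\begin{pmatrix}G_x^{-1}&-\dfrac{G_x^{-1}g_x}{\gamma_x}\\[2mm] -\dfrac{g_x^TG_x^{-1}}{\gamma_x}&\dfrac{1+g_x^TG_x^{-1}g_x}{\gamma_x^2}\end{pmatrix}.$$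
   Context: $\mathcal{R}(X)$ denotes the range (column space) of $X$. The matrix $G_{x,new}$ equals $\widetilde X_{new}\widetilde X_{new}^T$, where $(X\;\;x_{new})=Q_{x,new}\widetilde X_{new}$ with $Q_{x,new}=(Q_x\;\;(x_{new}-Q_xg_x)/\gamma_x)$ and $\widetilde X_{new}=\begin{pmatrix}\widetilde X&g_x\\ \mathbf{0}&\gamma_x\end{pmatrix}$ is the factorization updated by a Gram–Schmidt step. *)

theory Defs
  imports
    "HOL.NthRoot"
    "Jordan_Normal_Form.Gauss_Jordan_Elimination"
    "Jordan_Normal_Form.DL_Rank"
begin

definition orthonormal_cols :: "real mat \<Rightarrow> bool" where
  "orthonormal_cols Q \<longleftrightarrow>
     (\<forall>i < dim_col Q. \<forall>j < dim_col Q. col Q i \<bullet> col Q j = (if i = j then 1 else 0))"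

(* The first argument of vec_space.rank is the length of the columns, not the expected rank. *)
definition full_row_rank :: "real mat \<Rightarrow> bool" where
  "full_row_rank A \<longleftrightarrow> vec_space.rank (dim_row A) A = dim_row A"

definition norm2_vec :: "real vec \<Rightarrow> real" where
  "norm2_vec v = sqrt (\<Sum>i < dim_vec v. (v $ i)\<^sup>2)"

(* mat_inverse returns None on non-invertible matrices, so mat_inv A is unspecified for these. *)
definition mat_inv :: "real mat \<Rightarrow> real mat" where
  "mat_inv A = the (mat_inverse A)"

lemma mat_inv_inverts:
  assumes "invertible_mat A"
  shows "inverts_mat A (mat_inv A)" and "inverts_mat (mat_inv A) A"
proof -
  define n where "n = dim_row A"
  have A: "A \<in> carrier_mat n n"
    using assms by (auto simp: invertible_mat_def n_def)
  from assms obtain B where AB: "A * B = 1\<^sub>m (dim_row A)" and BA: "B * A = 1\<^sub>m (dim_row B)"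
    by (auto simp: invertible_mat_def inverts_mat_def)
  have "dim_col B = n" using arg_cong[OF AB, of dim_col] by (simp add: n_def)
  moreover have "dim_row B = n" using arg_cong[OF BA, of dim_col] A by simp
  ultimately have B: "B \<in> carrier_mat n n" by auto
  have "A \<in> Units (ring_mat TYPE(real) n ())"
    using A B AB BA by (auto simp: Units_def ring_mat_def)
  with mat_inverse(1)[OF A, of "()"] obtain C where C: "mat_inverse A = Some C" by fastforce
  from mat_inverse(2)[OF A C] C A
  show "inverts_mat A (mat_inv A)" "inverts_mat (mat_inv A) A"
    by (auto simp: inverts_mat_def mat_inv_def)
qed

definition col_mat :: "real vec \<Rightarrow> real mat" where
  "col_mat v = mat_of_cols (dim_vec v) [v]"

definition scalar_mat :: "real \<Rightarrow> real mat" where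
  "scalar_mat c = mat 1 1 (\<lambda>_. c)"

end

theory Submission
  imports Defs
begin

text \<open>Full row rank makes \<open>Xt\<close> surjective, so \<open>Xt\<^sup>T\<close> is injective and the Gram matrix \<open>Xt * Xt\<^sup>T\<close>
  is nonsingular. Surjectivity also gives that the ranges of \<open>Qx\<close> and \<open>X = Qx * Xt\<close> coincide, so
  the residual of a snapshot outside the range of \<open>X\<close> does not vanish, i.e. \<open>\<gamma>x \<noteq> 0\<close>. The claimed
  inverse is then confirmed by a blockwise multiplication, in which everything reduces to the
  scalar \<open>q = gx \<bullet> (mat_inv Gx *\<^sub>v gx)\<close>.\<close>

text \<open>A maximal independent set of columns has as many elements as the rank, here
  \<open>n\<close>, which is the dimension of the space. Such a set is a basis, so the columns span
  everything.\<close>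

lemma (in vec_space) full_rank_col_space:
  assumes A: "A \<in> carrier_mat n nc" and r: "rank A = n"
  shows "col_space A = carrier_vec n"
proof -
  let ?P = "\<lambda>T. T \<subseteq> set (cols A) \<and> lin_indpt T"
  have sub: "set (cols A) \<subseteq> carrier_vec n" using A cols_dim by blast
  \<comment> \<open>The empty set is the seed from which a maximal independent set of columns is
    grown.\<close>
  have "?P {}" by (simp add: lin_dep_def)
  then obtain S where S: "finite S" "maximal S ?P"
    using maximal_exists_superset[of "set (cols A)" ?P "{}"] by auto
  have P: "S \<subseteq> set (cols A)" "lin_indpt S" using S(2) by (auto simp: maximal_def)
  have "card S = n" using rank_card_indpt[OF A S(2)] r by simp
  then have "basis S"
    using dim_li_is_basis[OF fin_dim S(1)] P sub by (simp add: dim_is_n)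
  then have "carrier_vec n \<subseteq> span S" by (simp add: basis_def)
  also have "span S \<subseteq> span (set (cols A))" by (rule span_is_monotone[OF P(1)])
  finally show ?thesis unfolding col_space_def using span_closed[OF sub] by auto
qed

lemma full_row_rank_surj:
  assumes "A \<in> carrier_mat n nc" "full_row_rank A" "y \<in> carrier_vec n"
  obtains x where "x \<in> carrier_vec nc" "A *\<^sub>v x = y"
proof -
  interpret vec_space "TYPE(real)" n .
  have "y \<in> col_space A"
    using full_rank_col_space[OF assms(1)] assms by (simp add: full_row_rank_def)
  then show ?thesis using that assms(1) by (auto simp: col_space_eq)
qed

text \<open>For square matrices over a field a right inverse is also a left inverse, so checking a
  single product is enough.\<close>

lemma invertible_matI:
  fixes A :: "real mat"
  assumes "A \<in> carrier_mat n n" "B \<in> carrier_mat n n" "A * B = 1\<^sub>m n"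
  shows "invertible_mat A"
  using assms mat_mult_left_right_inverse[OF assms]
  by (auto simp: invertible_mat_def inverts_mat_def square_mat.simps)

lemma mat_inv_mult:
  assumes A: "A \<in> carrier_mat n n" and "invertible_mat A"
  shows "mat_inv A \<in> carrier_mat n n" "A * mat_inv A = 1\<^sub>m n" "mat_inv A * A = 1\<^sub>m n"
proof -
  have 1: "A * mat_inv A = 1\<^sub>m n" and 2: "mat_inv A * A = 1\<^sub>m (dim_row (mat_inv A))"
    using mat_inv_inverts[OF assms(2)] A by (auto simp: inverts_mat_def)
  \<comment> \<open>The shape of \<open>mat_inv A\<close> is read off from the two product
    equations: the first fixes its number of columns, the second its number of rows.\<close>
  show c: "mat_inv A \<in> carrier_mat n n"
    using arg_cong[OF 1, of dim_col] arg_cong[OF 2, of dim_col] A by auto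
  show "A * mat_inv A = 1\<^sub>m n" by (fact 1)
  show "mat_inv A * A = 1\<^sub>m n" using 2 c by simp
qed

text \<open>Multiplying \<open>A * B\<close> by \<open>mat_inv A\<close> from the left isolates
  \<open>B\<close>. This turns a verified product into a closed form for \<open>mat_inv\<close>,
  which is defined through Gauss-Jordan elimination.\<close>

lemma mat_inv_unique:
  assumes A: "A \<in> carrier_mat n n" and B: "B \<in> carrier_mat n n" and AB: "A * B = 1\<^sub>m n"
  shows "mat_inv A = B"
proof -
  note I = mat_inv_mult[OF A invertible_matI[OF assms]]
  have "mat_inv A = mat_inv A * (A * B)" using I AB by simp
  also have "\<dots> = (mat_inv A * A) * B" using A B I(1) by simp
  finally show ?thesis using I B by simp
qed

lemma norm2_vec_eq_0:
  assumes "v \<in> carrier_vec n" "norm2_vec v = 0"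
  shows "v = 0\<^sub>v n"
  using assms by (auto simp: norm2_vec_def sum_nonneg_eq_0_iff intro!: eq_vecI)

lemma norm2_vec_scalar_prod: "norm2_vec v = sqrt (v \<bullet> v)"
  by (simp add: norm2_vec_def scalar_prod_def power2_eq_square atLeast0LessThan)

text \<open>A kernel vector \<open>v\<close> of the Gram matrix satisfies
  \<open>v \<bullet> (?G *\<^sub>v v) = 0\<close>, which is the squared norm of
  \<open>A\<^sup>T *\<^sub>v v\<close>; so \<open>v\<close> lies in the kernel of the transpose,
  which is trivial.\<close>

lemma invertible_gram_mat:
  assumes A: "A \<in> carrier_mat n nc" and fr: "full_row_rank A"
  shows "invertible_mat (A * A\<^sup>T)"
proof -
  let ?G = "A * A\<^sup>T"
  have G: "?G \<in> carrier_mat n n" using A by auto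
  have "v = 0\<^sub>v n" if v: "v \<in> carrier_vec n" and z: "?G *\<^sub>v v = 0\<^sub>v n" for v
  proof -
    let ?w = "A\<^sup>T *\<^sub>v v"
    have w: "?w \<in> carrier_vec nc" using A v by simp
    have "?w \<bullet> ?w = v \<bullet> (A *\<^sub>v ?w)"
      by (rule transpose_vec_mult_scalar[OF A w v])
    also have "A *\<^sub>v ?w = 0\<^sub>v n" using z A v by simp
    finally have "?w \<bullet> ?w = 0" using v by simp
    then have w0: "?w = 0\<^sub>v nc" using norm2_vec_eq_0[OF w] by (simp add: norm2_vec_scalar_prod)
    \<comment> \<open>Surjectivity of \<open>A\<close> gives injectivity of the transpose: with
      \<open>v\<close> as an image, \<open>v \<bullet> v\<close> moves over to
      \<open>?w \<bullet> x\<close>, where \<open>?w\<close> is zero.\<close>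
    obtain x where x: "x \<in> carrier_vec nc" "A *\<^sub>v x = v"
      by (rule full_row_rank_surj[OF A fr v])
    have "v \<bullet> v = ?w \<bullet> x"
      using transpose_vec_mult_scalar[OF A x(1) v] x by simp
    then have "v \<bullet> v = 0" using w0 x by simp
    then show ?thesis using norm2_vec_eq_0[OF v] by (simp add: norm2_vec_scalar_prod)
  qed
  then have "det ?G \<noteq> 0" using det_0_iff_vec_prod_zero_field[OF G] by auto
  from det_non_zero_imp_unit[OF G this, of "()"]
  obtain B where "B \<in> carrier_mat n n" "?G * B = 1\<^sub>m n"
    by (auto simp: Units_def ring_mat_def)
  then show ?thesis using invertible_matI[OF G] by blast
qed

text \<open>A vanishing residual would put \<open>x\<close> into the range of \<open>Q\<close>.
  Every \<open>Q *\<^sub>v g\<close> already lies in the range of \<open>Q * A\<close>, because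
  \<open>g\<close> has a preimage under \<open>A\<close>.\<close>

lemma residual_norm_nonzero:
  assumes Q: "Q \<in> carrier_mat m r" and A: "A \<in> carrier_mat r n" and fr: "full_row_rank A"
    and x: "x \<in> carrier_vec m" and nx: "x \<notin> vec_space.col_space m (Q * A)"
    and g: "g \<in> carrier_vec r"
  shows "norm2_vec (x - Q *\<^sub>v g) \<noteq> 0"
proof
  interpret vec_space "TYPE(real)" m .
  assume "norm2_vec (x - Q *\<^sub>v g) = 0"
  then have z: "x - Q *\<^sub>v g = 0\<^sub>v m" by (rule norm2_vec_eq_0[rotated]) (use Q g x in simp)
  have xQ: "x = Q *\<^sub>v g"
  proof (rule eq_vecI)
    fix i assume "i < dim_vec (Q *\<^sub>v g)"
    then have "i < m" using Q by simp
    then show "x $ i = (Q *\<^sub>v g) $ i" using arg_cong[OF z, of "\<lambda>v. v $ i"] x Q by simp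
  qed (use x Q in simp)
  obtain w where w: "w \<in> carrier_vec n" "A *\<^sub>v w = g"
    by (rule full_row_rank_surj[OF A fr g])
  have "(Q * A) *\<^sub>v w = x"
    unfolding assoc_mult_mat_vec[OF Q A w(1)] w(2) by (rule xQ[symmetric])
  moreover have QA: "Q * A \<in> carrier_mat m n" using Q A by simp
  ultimately have "\<exists>y\<in>carrier_vec (dim_col (Q * A)). (Q * A) *\<^sub>v y = x"
    using w(1) A by (intro bexI[of _ w]) simp_all
  then have "x \<in> col_space (Q * A)"
    unfolding col_space_eq[OF QA] using x Q by simp
  with nx show False ..
qed

lemma col_mat_carrier: "g \<in> carrier_vec r \<Longrightarrow> col_mat g \<in> carrier_mat r 1"
  by (auto simp: col_mat_def)

lemma scalar_mat_carrier: "scalar_mat a \<in> carrier_mat 1 1"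
  by (simp add: scalar_mat_def)

lemma scalar_mat_add: "scalar_mat a + scalar_mat b = scalar_mat (a + b)"
  by (auto simp: scalar_mat_def)

lemma smult_scalar_mat: "a \<cdot>\<^sub>m scalar_mat b = scalar_mat (a * b)"
  by (auto simp: scalar_mat_def)

lemma smult_smult_mat:
  fixes A :: "'a :: semigroup_mult mat"
  shows "a \<cdot>\<^sub>m (b \<cdot>\<^sub>m A) = (a * b) \<cdot>\<^sub>m A"
  by (intro eq_matI) (auto simp: mult.assoc)

lemma scalar_mat_1: "scalar_mat 1 = 1\<^sub>m 1"
  by (auto simp: scalar_mat_def)

lemma mult_scalar_mat:
  assumes "A \<in> carrier_mat r 1"
  shows "A * scalar_mat a = a \<cdot>\<^sub>m A"
  using assms by (intro eq_matI) (auto simp: scalar_mat_def scalar_prod_def)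

lemma scalar_mat_mult:
  assumes "A \<in> carrier_mat 1 r"
  shows "scalar_mat a * A = a \<cdot>\<^sub>m A"
  using assms by (intro eq_matI) (auto simp: scalar_mat_def scalar_prod_def)

text \<open>Identifies the only 1 by 1 product in the block computation with a real number, so that
  the remaining algebra takes place among scalars.\<close>

lemma col_mat_quadratic_form:
  assumes g: "g \<in> carrier_vec r" and P: "P \<in> carrier_mat r r"
  shows "(col_mat g)\<^sup>T * (P * col_mat g) = scalar_mat (g \<bullet> (P *\<^sub>v g))"
proof -
  have "col (col_mat g) 0 = g" using g by (auto simp: col_mat_def)
  then show ?thesis using g P
    by (intro eq_matI) (auto simp: scalar_mat_def col_mat_def scalar_prod_def)
qed

lemma append_rows_outer_product:
  assumes g: "g \<in> carrier_vec r"
  shows "(col_mat g @\<^sub>r scalar_mat a) * (col_mat g @\<^sub>r scalar_mat a)\<^sup>T =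
    four_block_mat (col_mat g * (col_mat g)\<^sup>T) (a \<cdot>\<^sub>m col_mat g) (a \<cdot>\<^sub>m (col_mat g)\<^sup>T) (scalar_mat (a\<^sup>2))"
  using g
  by (intro eq_matI)
     (auto simp: append_rows_def col_mat_def mat_of_cols_def scalar_mat_def scalar_prod_def power2_eq_square)

text \<open>The Schur complement of the corner \<open>a\<^sup>2\<close> is \<open>G\<close>, since
  the border removes exactly the rank-one term; hence the upper left block of the inverse is
  \<open>P\<close>. The four blocks of the product are checked one by one.\<close>

lemma bordered_gram_inverse:
  fixes G P :: "real mat"
  assumes G: "G \<in> carrier_mat r r" and P: "P \<in> carrier_mat r r" and GP: "G * P = 1\<^sub>m r"
    and g: "g \<in> carrier_vec r" and a: "a \<noteq> 0"
  shows "four_block_mat (G + col_mat g * (col_mat g)\<^sup>T) (a \<cdot>\<^sub>m col_mat g) (a \<cdot>\<^sub>m (col_mat g)\<^sup>T) (scalar_mat (a\<^sup>2))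
    * four_block_mat P ((- 1 / a) \<cdot>\<^sub>m (P * col_mat g)) ((- 1 / a) \<cdot>\<^sub>m ((col_mat g)\<^sup>T * P))
        (scalar_mat ((1 + g \<bullet> (P *\<^sub>v g)) / a\<^sup>2)) = 1\<^sub>m (r + 1)"
    (is "?M * ?N = _")
proof -
  define c where "c = col_mat g"
  define q where "q = g \<bullet> (P *\<^sub>v g)"
  have c: "c \<in> carrier_mat r 1" and ct: "c\<^sup>T \<in> carrier_mat 1 r" using g by (auto simp: c_def col_mat_def)
  have Pc: "P * c \<in> carrier_mat r 1" and cP: "c\<^sup>T * P \<in> carrier_mat 1 r" using P c ct by auto
  have quad: "c\<^sup>T * (P * c) = scalar_mat q"
    unfolding c_def q_def by (rule col_mat_quadratic_form[OF g P])
  have GPc: "G * (P * c) = c"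
    using assoc_mult_mat[OF G P c] GP c by simp
  have ccPc: "c * c\<^sup>T * (P * c) = q \<cdot>\<^sub>m c"
    using assoc_mult_mat[OF c ct Pc] quad mult_scalar_mat[OF c] by simp
  have ccP: "c * c\<^sup>T * P = c * (c\<^sup>T * P)"
    by (rule assoc_mult_mat[OF c ct P])
  have cc: "c * c\<^sup>T \<in> carrier_mat r r" using c ct by simp
  \<comment> \<open>The factors \<open>a\<close> and \<open>- 1 / a\<close> cancel, so the border
    contributes the negative of the rank-one part and only \<open>G * P\<close> survives.\<close>
  have 11: "(G + c * c\<^sup>T) * P + (a \<cdot>\<^sub>m c) * ((- 1 / a) \<cdot>\<^sub>m (c\<^sup>T * P)) = 1\<^sub>m r"
  proof -
    have "(a \<cdot>\<^sub>m c) * ((- 1 / a) \<cdot>\<^sub>m (c\<^sup>T * P)) = (- 1) \<cdot>\<^sub>m (c * (c\<^sup>T * P))"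
      using a cP by (simp add: mult_smult_assoc_mat[OF c, of _ r] mult_smult_distrib[OF c cP] smult_smult_mat)
    then show ?thesis
      using c P cP by (simp add: add_mult_distrib_mat[OF G cc P] GP ccP) (intro eq_matI, auto)
  qed
  \<comment> \<open>Both summands are multiples of \<open>c\<close>, with factors
    \<open>- (1 + q) / a\<close> and \<open>(1 + q) / a\<close>. This is where the corner entry of
    the inverse comes from.\<close>
  have 12: "(G + c * c\<^sup>T) * ((- 1 / a) \<cdot>\<^sub>m (P * c)) + (a \<cdot>\<^sub>m c) * scalar_mat ((1 + q) / a\<^sup>2) = 0\<^sub>m r 1"
  proof -
    have "(G + c * c\<^sup>T) * ((- 1 / a) \<cdot>\<^sub>m (P * c)) = (- 1 / a) \<cdot>\<^sub>m (c + q \<cdot>\<^sub>m c)"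
      using G cc by (simp add: mult_smult_distrib[OF _ Pc, of _ r] add_mult_distrib_mat[OF G cc Pc] GPc ccPc)
    moreover have "(a \<cdot>\<^sub>m c) * scalar_mat ((1 + q) / a\<^sup>2) = ((1 + q) / a) \<cdot>\<^sub>m c"
      using c a by (simp add: mult_scalar_mat[of _ r] smult_smult_mat power2_eq_square)
    ultimately show ?thesis
      using c a by (intro eq_matI) (auto simp: field_simps)
  qed
  have 21: "(a \<cdot>\<^sub>m c\<^sup>T) * P + scalar_mat (a\<^sup>2) * ((- 1 / a) \<cdot>\<^sub>m (c\<^sup>T * P)) = 0\<^sub>m 1 r"
  proof -
    have "(a \<cdot>\<^sub>m c\<^sup>T) * P = a \<cdot>\<^sub>m (c\<^sup>T * P)" by (rule mult_smult_assoc_mat[OF ct P])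
    moreover have "scalar_mat (a\<^sup>2) * ((- 1 / a) \<cdot>\<^sub>m (c\<^sup>T * P)) = (- a) \<cdot>\<^sub>m (c\<^sup>T * P)"
      using cP a by (simp add: scalar_mat_mult[of _ r] smult_smult_mat power2_eq_square)
    ultimately show ?thesis
      using c P by (intro eq_matI) auto
  qed
  have 22: "(a \<cdot>\<^sub>m c\<^sup>T) * ((- 1 / a) \<cdot>\<^sub>m (P * c)) + scalar_mat (a\<^sup>2) * scalar_mat ((1 + q) / a\<^sup>2) = 1\<^sub>m 1"
  proof -
    have "(a \<cdot>\<^sub>m c\<^sup>T) * ((- 1 / a) \<cdot>\<^sub>m (P * c)) = scalar_mat (- q)"
      using a Pc by (simp add: mult_smult_assoc_mat[OF ct, of _ 1] mult_smult_distrib[OF ct Pc]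
          smult_smult_mat quad smult_scalar_mat)
    moreover have "scalar_mat (a\<^sup>2) * scalar_mat ((1 + q) / a\<^sup>2) = scalar_mat (1 + q)"
      using a by (simp add: mult_scalar_mat[OF scalar_mat_carrier] smult_scalar_mat)
    ultimately show ?thesis by (simp add: scalar_mat_add scalar_mat_1)
  qed
  show ?thesis
    unfolding c_def[symmetric] q_def[symmetric]
    \<comment> \<open>The block sizes occur only in the side conditions of the rule, so they are
      given explicitly.\<close>
    by (subst mult_four_block_mat[where ?nr1.0 = r and ?n1.0 = r and ?n2.0 = 1 and ?nr2.0 = 1 and ?nc1.0 = r and ?nc2.0 = 1])
       (use G P c ct cc Pc cP scalar_mat_carrier 11 12 21 22 in simp_all)
qed

theorem proposition5p2:
  fixes X Qx Xt Gx Gnew :: "real mat"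
    and xnew gx :: "real vec"
    and \<gamma>x :: real
    and m n rx :: nat
  assumes "X \<in> carrier_mat m n"
    and "Qx \<in> carrier_mat m rx"
    and "Xt \<in> carrier_mat rx n"
    and "X = Qx * Xt"
    and "orthonormal_cols Qx"
    and "full_row_rank Xt"
    and "Gx = Xt * Xt\<^sup>T"
    and "xnew \<in> carrier_vec m"
    and "xnew \<notin> vec_space.col_space m X"
    and "gx = Qx\<^sup>T *\<^sub>v xnew"
    and "\<gamma>x = norm2_vec (xnew - Qx *\<^sub>v gx)"
    and "Gnew = four_block_mat Gx (0\<^sub>m rx 1) (0\<^sub>m 1 rx) (0\<^sub>m 1 1)
                + (col_mat gx @\<^sub>r scalar_mat \<gamma>x) * (col_mat gx @\<^sub>r scalar_mat \<gamma>x)\<^sup>T"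
  shows "invertible_mat Gx \<and> invertible_mat Gnew \<and>
    mat_inv Gnew =
      four_block_mat
        (mat_inv Gx)
        ((- 1 / \<gamma>x) \<cdot>\<^sub>m (mat_inv Gx * col_mat gx))
        ((- 1 / \<gamma>x) \<cdot>\<^sub>m ((col_mat gx)\<^sup>T * mat_inv Gx))
        (scalar_mat ((1 + gx \<bullet> (mat_inv Gx *\<^sub>v gx)) / \<gamma>x\<^sup>2))"
proof -
  note [simp] = assms(2,3,8)
  have g: "gx \<in> carrier_vec rx" using assms(2,8) unfolding assms(10) by (intro mult_mat_vec_carrier[of _ _ m]) auto
  have G: "Gx \<in> carrier_mat rx rx" unfolding assms(7) by (intro mult_carrier_mat[of _ _ n]) auto
  have iG: "invertible_mat Gx" unfolding assms(7) by (rule invertible_gram_mat[OF assms(3,6)])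
  note P = mat_inv_mult[OF G iG]
  have a: "\<gamma>x \<noteq> 0"
    unfolding assms(11) using residual_norm_nonzero[OF assms(2,3,6,8) _ g] assms(4,9) by simp
  let ?M = "four_block_mat (Gx + col_mat gx * (col_mat gx)\<^sup>T) (\<gamma>x \<cdot>\<^sub>m col_mat gx)
    (\<gamma>x \<cdot>\<^sub>m (col_mat gx)\<^sup>T) (scalar_mat (\<gamma>x\<^sup>2))"
  let ?N = "four_block_mat (mat_inv Gx) ((- 1 / \<gamma>x) \<cdot>\<^sub>m (mat_inv Gx * col_mat gx))
    ((- 1 / \<gamma>x) \<cdot>\<^sub>m ((col_mat gx)\<^sup>T * mat_inv Gx))
    (scalar_mat ((1 + gx \<bullet> (mat_inv Gx *\<^sub>v gx)) / \<gamma>x\<^sup>2))"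
  have c: "col_mat gx \<in> carrier_mat rx 1" using g by (rule col_mat_carrier)
  \<comment> \<open>Adding the outer product to the zero-padded \<open>Gx\<close> blockwise leaves
    the bordered shape treated above.\<close>
  have M: "Gnew = ?M"
    unfolding assms(12) append_rows_outer_product[OF g]
    by (subst add_four_block_mat[where ?nr1.0 = rx and ?nc1.0 = rx and ?nr2.0 = 1 and ?nc2.0 = 1])
       (use G c scalar_mat_carrier in simp_all)
  have Mc: "Gnew \<in> carrier_mat (rx + 1) (rx + 1)"
    unfolding M by (rule four_block_carrier_mat) (use G c scalar_mat_carrier in simp_all)
  have Nc: "?N \<in> carrier_mat (rx + 1) (rx + 1)"
    by (rule four_block_carrier_mat) (use P scalar_mat_carrier in simp_all)
  \<comment> \<open>This one product yields both invertibility of \<open>Gnew\<close> and the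
    formula for its inverse.\<close>
  have MN: "Gnew * ?N = 1\<^sub>m (rx + 1)"
    unfolding M by (rule bordered_gram_inverse[OF G P(1,2) g a])
  show ?thesis
    using iG invertible_matI[OF Mc Nc MN] mat_inv_unique[OF Mc Nc MN] by blast
qed

end
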